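(* Let $X$ be either $\ell_\infty$ (bounded real sequences) or $c$ (convergent real sequences), with the supremum norm, and let $B_X$ be its closed unit ball. Then there exists an approximately convex function $f:B_X\to\mathbb{R}$ which is nontrivial, i.e. $\sup_{x\in B_X}|f(x)-g(x)|=\infty$ for every convex function $g:B_X\to\mathbb{R}$.
   Context: For a convex set $D$, a function $f:D\to\mathbb{R}$ is $\varepsilon$-convex if $f(tx+(1-t)y)\le tf(x)+(1-t)f(y)+\varepsilon$ for all $x,y\in D$, $t\in[0,1]$. It is approximately convex if it is $\varepsilon$-convex for some $\varepsilon$. *)

theory Defs
  imports "HOL-Analysis.Analysis"
begin

definition eps_convex_on :: "real \<Rightarrow> 'a::real_vector set \<Rightarrow> ('a \<Rightarrow> real) \<Rightarrow> bool" where
  "eps_convex_on \<epsilon> D f \<longleftrightarrow> convex D \<and>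
     (\<forall>x\<in>D. \<forall>y\<in>D. \<forall>t\<in>{0..1}.
        f (t *\<^sub>R x + (1 - t) *\<^sub>R y) \<le> t * f x + (1 - t) * f y + \<epsilon>)"

definition approx_convex_on :: "'a::real_vector set \<Rightarrow> ('a \<Rightarrow> real) \<Rightarrow> bool" where
  "approx_convex_on D f \<longleftrightarrow> (\<exists>\<epsilon>. eps_convex_on \<epsilon> D f)"

text \<open>
  Every function on \<^typ>\<open>nat\<close> is continuous, so the type of bounded continuous functions
  from \<^typ>\<open>nat\<close> to \<^typ>\<open>real\<close> is the space of all bounded real sequences, and its library
  norm is the supremum norm; the two lemmas below record this.
\<close>

type_synonym bounded_seq = "nat \<Rightarrow>\<^sub>C real"

lemma range_apply_bounded_seq:
  "range (apply_bcontfun :: bounded_seq \<Rightarrow> nat \<Rightarrow> real) = {x. Bseq x}"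
proof -
  have "bcontfun = {x :: nat \<Rightarrow> real. Bseq x}"
    by (auto simp: bcontfun_def Bseq_eq_bounded)
  then show ?thesis
    using type_definition.Rep_range[OF type_definition_bcontfun] by simp
qed

lemma norm_bounded_seq: "norm (x :: bounded_seq) = (SUP n. \<bar>apply_bcontfun x n\<bar>)"
  unfolding norm_bcontfun_def dist_bcontfun_def by (simp add: dist_real_def)

definition ell_infinity :: "bounded_seq set" where
  "ell_infinity = UNIV"

definition convergent_seqs :: "bounded_seq set" where
  "convergent_seqs = {x. convergent (apply_bcontfun x)}"

lemma subspace_ell_infinity: "subspace ell_infinity"
  by (simp add: ell_infinity_def)

lemma subspace_convergent_seqs: "subspace convergent_seqs"
  unfolding subspace_def convergent_seqs_def
  by (auto simp: convergent_add convergent_const intro!: convergent_mult)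

text \<open>
  The subspaces carry the restricted norm, so the closed unit ball of \<open>X\<close> is the trace on \<open>X\<close>
  of the closed unit ball of the ambient space.
\<close>

definition unit_ball :: "'a::real_normed_vector set \<Rightarrow> 'a set" where
  "unit_ball X = X \<inter> cball 0 1"

end

theory Submission
  imports Defs
begin

text \<open>
  If \<open>M > 0\<close> satisfies \<open>M (t x + (1 - t) y) \<ge> max (t M x) ((1 - t) M y)\<close>, then \<open>- ln M\<close> is
  approximately convex, because \<open>- t ln t - (1 - t) ln (1 - t)\<close> is bounded. On the unit ball this
  applies to \<open>M x = max (1 / (n + 1)) (1 + sup x)\<close>. If \<open>v\<^sub>j\<close> is the sequence with entry \<open>1\<close> at \<open>j\<close>
  and \<open>- 1\<close> elsewhere, then \<open>- ln M \<le> 0\<close> at each \<open>v\<^sub>j\<close>, whereas \<open>- ln M \<ge> ln ((n + 1) / 2)\<close> at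
  the mean of any \<open>n + 1\<close> of them; a convex function therefore cannot stay within a bounded
  distance as \<open>n\<close> grows.

  To take a pointwise finite supremum over \<open>n\<close>, split the \<open>v\<^sub>j\<close> into countably many infinite
  families. As they are linearly independent, a Hamel basis gives (discontinuous) functionals
  \<open>\<sigma>\<^sub>n\<close> that are \<open>1\<close> on the \<open>n\<close>-th family, \<open>0\<close> on the others, and such that for every \<open>x\<close> only finitely
  many \<open>\<sigma>\<^sub>n x\<close> are nonzero. Adding the affine function \<open>ln (n + 1) (\<sigma>\<^sub>n x - 1)\<close> to the \<open>n\<close>-th
  function leaves its values on the \<open>n\<close>-th family unchanged and makes it at most \<open>0\<close> wherever
  \<open>\<sigma>\<^sub>n x = 0\<close>.
\<close>

section \<open>Linear functionals separating countably many families\<close>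

lemma independent_family_functionals:
  fixes v :: "nat \<Rightarrow> 'i \<Rightarrow> 'a::real_vector"
  assumes ind: "independent (range (case_prod v))" and inj: "inj (case_prod v)"
  obtains \<sigma> :: "nat \<Rightarrow> 'a \<Rightarrow> real"
    where "\<And>n. linear (\<sigma> n)"
      and "\<And>n m i. \<sigma> n (v m i) = (if m = n then 1 else 0)"
      and "\<And>x. \<forall>\<^sub>F n in sequentially. \<sigma> n x = 0"
proof -
  define B where "B = real_vector.extend_basis (range (case_prod v))"
  have B: "range (case_prod v) \<subseteq> B" "independent B" "span B = UNIV"
    using real_vector.extend_basis_superset[OF ind] real_vector.independent_extend_basis[OF ind]
      real_vector.span_extend_basis[OF ind] by (auto simp: B_def)
  have vB: "v m i \<in> B" for m i
    using B(1) by (metis case_prod_conv rangeI subsetD)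
  have v_inj: "m = n" if "v m i = v n j" for m n i j
    using injD[OF inj, of "(m, i)" "(n, j)"] that by simp
  have "\<forall>n. \<exists>s. linear s \<and> (\<forall>b\<in>B. s b = (if b \<in> range (v n) then 1 else 0 :: real))"
    by (intro allI linear_independent_extend[OF B(2)])
  from choice[OF this] obtain \<sigma> :: "nat \<Rightarrow> 'a \<Rightarrow> real" where
    *: "\<forall>n. linear (\<sigma> n) \<and> (\<forall>b\<in>B. \<sigma> n b = (if b \<in> range (v n) then 1 else 0))" ..
  have \<sigma>: "linear (\<sigma> n)" "b \<in> B \<Longrightarrow> \<sigma> n b = (if b \<in> range (v n) then 1 else 0)" for n b
    using *[rule_format, of n] by simp_all
  have val: "\<sigma> n (v m i) = (if m = n then 1 else 0)" for n m i
    using \<sigma>(2)[OF vB[of m i], of n] v_inj by fastforce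
  \<comment> \<open>The vectors killed by almost all \<open>\<sigma> n\<close> form a subspace, so
    it suffices to test the basis \<open>B\<close>. A basis vector lies in at most one family, hence
    at most one \<open>\<sigma> n\<close> is nonzero there.\<close>
  let ?Z = "{x. \<forall>\<^sub>F n in sequentially. \<sigma> n x = 0}"
  have "subspace ?Z"
  proof (rule subspaceI)
    show "0 \<in> ?Z"
      by (simp add: linear_0[OF \<sigma>(1)])
    show "x + y \<in> ?Z" if "x \<in> ?Z" "y \<in> ?Z" for x y
      using that unfolding mem_Collect_eq by eventually_elim (simp add: linear_add[OF \<sigma>(1)])
    show "c *\<^sub>R x \<in> ?Z" if "x \<in> ?Z" for c x
      using that unfolding mem_Collect_eq by eventually_elim (simp add: linear_cmul[OF \<sigma>(1)])
  qed
  moreover have "b \<in> ?Z" if "b \<in> B" for b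
  proof (cases "\<exists>m i. b = v m i")
    case True
    then obtain m i where b: "b = v m i"
      by blast
    show ?thesis
      using eventually_gt_at_top[of m] unfolding mem_Collect_eq
      by eventually_elim (simp add: b val)
  next
    case False
    then have "b \<notin> range (v n)" for n
      by blast
    then show ?thesis
      using \<sigma>(2)[OF that] by simp
  qed
  ultimately have "span B \<subseteq> ?Z"
    by (intro span_minimal subsetI)
  then have "\<forall>\<^sub>F n in sequentially. \<sigma> n x = 0" for x
    using B(3) by blast
  then show thesis
    by (rule that[OF \<sigma>(1) val])
qed

section \<open>Constructions of approximately convex functions\<close>

lemma eps_convex_on_SUP:
  fixes f :: "'i \<Rightarrow> 'a::real_vector \<Rightarrow> real"
  assumes "I \<noteq> {}" and "\<And>i. i \<in> I \<Longrightarrow> eps_convex_on \<epsilon> D (f i)"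
    and bdd: "\<And>x. x \<in> D \<Longrightarrow> bdd_above ((\<lambda>i. f i x) ` I)"
  shows "eps_convex_on \<epsilon> D (\<lambda>x. SUP i\<in>I. f i x)"
  unfolding eps_convex_on_def
proof (intro conjI ballI)
  show "convex D"
    using assms(1,2) by (auto simp: eps_convex_on_def)
  fix x y t assume xy: "x \<in> D" "y \<in> D" and t: "t \<in> {0..1::real}"
  show "(SUP i\<in>I. f i (t *\<^sub>R x + (1 - t) *\<^sub>R y))
    \<le> t * (SUP i\<in>I. f i x) + (1 - t) * (SUP i\<in>I. f i y) + \<epsilon>"
  proof (rule cSUP_least[OF assms(1)])
    fix i assume i: "i \<in> I"
    have "f i (t *\<^sub>R x + (1 - t) *\<^sub>R y) \<le> t * f i x + (1 - t) * f i y + \<epsilon>"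
      using assms(2)[OF i] xy t unfolding eps_convex_on_def by blast
    also have "\<dots> \<le> t * (SUP i\<in>I. f i x) + (1 - t) * (SUP i\<in>I. f i y) + \<epsilon>"
      using t i xy by (intro add_mono mult_left_mono cSUP_upper bdd) auto
    finally show "f i (t *\<^sub>R x + (1 - t) *\<^sub>R y)
      \<le> t * (SUP i\<in>I. f i x) + (1 - t) * (SUP i\<in>I. f i y) + \<epsilon>" .
  qed
qed

lemma eps_convex_on_add_linear:
  assumes f: "eps_convex_on \<epsilon> D f" and s: "linear s"
  shows "eps_convex_on \<epsilon> D (\<lambda>x. f x + c * (s x - 1))"
  unfolding eps_convex_on_def
proof (intro conjI ballI)
  show "convex D"
    using f by (simp add: eps_convex_on_def)
  fix x y t assume "x \<in> D" "y \<in> D" "t \<in> {0..1::real}"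
  then have "f (t *\<^sub>R x + (1 - t) *\<^sub>R y) \<le> t * f x + (1 - t) * f y + \<epsilon>"
    using f unfolding eps_convex_on_def by blast
  moreover have "s (t *\<^sub>R x + (1 - t) *\<^sub>R y) = t * s x + (1 - t) * s y"
    by (simp only: linear_add[OF s] linear_cmul[OF s] real_scaleR_def)
  ultimately show "f (t *\<^sub>R x + (1 - t) *\<^sub>R y) + c * (s (t *\<^sub>R x + (1 - t) *\<^sub>R y) - 1)
    \<le> t * (f x + c * (s x - 1)) + (1 - t) * (f y + c * (s y - 1)) + \<epsilon>"
    by (simp only:) argo
qed

text \<open>Write z for the convex combination. Taking logarithms in t M(x) \<le> M(z) and weighting
  by t costs - t ln t \<le> 1 - t, which is 1 - 1/t \<le> ln t multiplied by t. Exchanging x and y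
  costs at most t in the same way, and the two errors add up to 1.\<close>

lemma eps_convex_on_minus_ln:
  assumes D: "convex D" and pos: "\<And>x. x \<in> D \<Longrightarrow> M x > 0"
    and M: "\<And>x y t. x \<in> D \<Longrightarrow> y \<in> D \<Longrightarrow> t \<in> {0..1} \<Longrightarrow> M (t *\<^sub>R x + (1 - t) *\<^sub>R y) \<ge> t * M x"
  shows "eps_convex_on 1 D (\<lambda>x. - ln (M x))"
  unfolding eps_convex_on_def
proof (intro conjI ballI D)
  fix x y t assume xy: "x \<in> D" "y \<in> D" and t: "t \<in> {0..1::real}"
  define z where "z = t *\<^sub>R x + (1 - t) *\<^sub>R y"
  have z: "z \<in> D"
    using D xy t by (auto simp: z_def intro: convexD)
  have half: "a * - ln (M z) \<le> a * - ln (M w) + (1 - a)"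
    if a: "a \<in> {0..1}" and w: "w \<in> D" and le: "a * M w \<le> M z" for a w
  proof (cases "a = 0")
    case False
    then have a0: "a > 0"
      using a by simp
    have "ln a + ln (M w) \<le> ln (M z)"
      using ln_mono[OF le] a0 pos[OF w] pos[OF z] by (simp add: ln_mult)
    moreover have "1 - inverse a \<le> ln a"
      using ln_le_minus_one[of "inverse a"] a0 by (simp add: ln_inverse)
    ultimately have "a * (1 - inverse a + ln (M w)) \<le> a * ln (M z)"
      using a0 by (intro mult_left_mono) auto
    then show ?thesis
      using a0 by (simp add: algebra_simps)
  qed simp
  have "t * - ln (M z) \<le> t * - ln (M x) + (1 - t)"
    using half[OF t xy(1)] M[OF xy t] by (simp add: z_def)
  moreover have "(1 - t) * - ln (M z) \<le> (1 - t) * - ln (M y) + t"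
    using half[of "1 - t" y] M[OF xy(2,1), of "1 - t"] t xy(2) by (simp add: z_def add.commute)
  ultimately show "- ln (M (t *\<^sub>R x + (1 - t) *\<^sub>R y)) \<le> t * - ln (M x) + (1 - t) * - ln (M y) + 1"
    unfolding z_def[symmetric] by (simp add: algebra_simps)
qed

lemma subspace_convex_unit_ball: "subspace X \<Longrightarrow> convex (unit_ball X)"
  unfolding unit_ball_def by (intro convex_Int subspace_imp_convex convex_cball)

section \<open>The signed unit vectors\<close>

definition signed_unit :: "nat \<Rightarrow> bounded_seq" where
  "signed_unit j = Bcontfun (\<lambda>k. if k = j then 1 else - 1)"

lemma apply_signed_unit: "apply_bcontfun (signed_unit j) k = (if k = j then 1 else - 1)"
proof -
  have "(\<lambda>k. if k = j then 1 else - 1 :: real) \<in> bcontfun"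
    by (rule bcontfun_normI[where b = 1]) auto
  then show ?thesis
    by (simp add: signed_unit_def Bcontfun_inverse)
qed

lemma inj_signed_unit: "inj signed_unit"
proof (rule injI)
  fix i j assume "signed_unit i = signed_unit j"
  then have "apply_bcontfun (signed_unit i) i = apply_bcontfun (signed_unit j) i"
    by simp
  then show "i = j"
    by (simp add: apply_signed_unit split: if_splits)
qed

lemma apply_bcontfun_sum: "apply_bcontfun (\<Sum>i\<in>S. f i) k = (\<Sum>i\<in>S. apply_bcontfun (f i) k)"
  by (induction S rule: infinite_finite_induct) auto

text \<open>The vector with index j is the constant - 1 plus 2 at position j. This formula gives
  both linear independence and the values of the means.\<close>

lemma sum_signed_unit:
  assumes "finite J"
  shows "(\<Sum>j\<in>J. u j * apply_bcontfun (signed_unit j) k) = (if k \<in> J then 2 * u k else 0) - sum u J"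
proof -
  have "(\<Sum>j\<in>J. u j * apply_bcontfun (signed_unit j) k) = (\<Sum>j\<in>J. (if k = j then 2 * u j else 0) - u j)"
    by (intro sum.cong) (auto simp: apply_signed_unit)
  then show ?thesis
    using assms by (simp add: sum_subtractf)
qed

lemma independent_signed_unit: "independent (range signed_unit)"
proof
  assume "dependent (range signed_unit)"
  then obtain T u v where T: "finite T" "T \<subseteq> range signed_unit"
    and eq0: "(\<Sum>v\<in>T. u v *\<^sub>R v) = 0" and v: "v \<in> T" "u v \<noteq> 0"
    unfolding dependent_explicit by blast
  obtain J where J: "T = signed_unit ` J"
    using T(2) by (auto simp: subset_image_iff)
  have inj: "inj_on signed_unit J"
    using inj_signed_unit by (rule inj_on_subset) simp
  have fin: "finite J"
    using T(1) J inj finite_image_iff by blast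
  have "(\<Sum>j\<in>J. u (signed_unit j) *\<^sub>R signed_unit j) = 0"
    using eq0 by (simp add: J sum.reindex[OF inj])
  then have "apply_bcontfun (\<Sum>j\<in>J. u (signed_unit j) *\<^sub>R signed_unit j) k = 0" for k
    by simp
  then have *: "(if k \<in> J then 2 * u (signed_unit k) else 0) = (\<Sum>j\<in>J. u (signed_unit j))" for k
    using sum_signed_unit[OF fin, of "\<lambda>j. u (signed_unit j)" k] by (simp add: apply_bcontfun_sum)
  \<comment> \<open>A coordinate outside the finite support shows that the coefficients sum to 0;
    the coordinate j in \<open>J\<close> then reads 2 u = 0.\<close>
  obtain k where "k \<notin> J"
    using fin ex_new_if_finite infinite_UNIV_nat by blast
  then have "(\<Sum>j\<in>J. u (signed_unit j)) = 0"
    using *[of k] by simp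
  then have "u (signed_unit j) = 0" if "j \<in> J" for j
    using *[of j] that by simp
  then show False
    using v J by auto
qed

lemma signed_unit_in_unit_ball:
  assumes "X = ell_infinity \<or> X = convergent_seqs"
  shows "signed_unit j \<in> unit_ball X"
proof -
  have "norm (signed_unit j) \<le> 1"
    by (rule norm_bound) (simp add: apply_signed_unit)
  moreover have "\<forall>\<^sub>F k in sequentially. apply_bcontfun (signed_unit j) k = - 1"
    using eventually_gt_at_top[of j] by eventually_elim (simp add: apply_signed_unit)
  then have "convergent (apply_bcontfun (signed_unit j))"
    by (intro convergentI[where L = "- 1"] tendsto_eventually)
  ultimately show ?thesis
    using assms by (auto simp: unit_ball_def ell_infinity_def convergent_seqs_def)
qed

section \<open>The function 1 + sup x on the unit ball\<close>

definition elevation :: "bounded_seq \<Rightarrow> real" where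
  "elevation x = (SUP k. 1 + apply_bcontfun x k)"

lemma bdd_above_elevation:
  fixes x :: bounded_seq
  shows "bdd_above (range (\<lambda>k. 1 + apply_bcontfun x k))"
proof (rule bdd_aboveI2)
  show "1 + apply_bcontfun x k \<le> 1 + norm x" for k
    using norm_bounded[of x k] by simp
qed

text \<open>Every 1 + y_k is nonnegative, so dropping the y part of t (1 + x_k) + (1 - t) (1 + y_k)
  only decreases it. Division by t lets the supremum over x_k be taken; at t = 0 the claim is that
  \<open>elevation y\<close> is nonnegative.\<close>

lemma elevation_scale:
  assumes y: "norm y \<le> 1" and t: "t \<in> {0..1}"
  shows "t * elevation x \<le> elevation (t *\<^sub>R x + (1 - t) *\<^sub>R y)"
proof (cases "t = 0")
  case True
  have "0 \<le> 1 + apply_bcontfun y 0"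
    using norm_bounded[of y 0] y by simp
  also have "\<dots> \<le> elevation y"
    unfolding elevation_def by (rule cSUP_upper[OF _ bdd_above_elevation]) simp
  finally show ?thesis
    using True by simp
next
  case False
  then have t0: "t > 0"
    using t by simp
  have "1 + apply_bcontfun x k \<le> elevation (t *\<^sub>R x + (1 - t) *\<^sub>R y) / t" for k
  proof -
    have "(1 - t) * - 1 \<le> (1 - t) * apply_bcontfun y k"
      using norm_bounded[of y k] y t by (intro mult_left_mono) auto
    then have "t * (1 + apply_bcontfun x k) \<le> 1 + apply_bcontfun (t *\<^sub>R x + (1 - t) *\<^sub>R y) k"
      by (simp add: algebra_simps)
    also have "\<dots> \<le> elevation (t *\<^sub>R x + (1 - t) *\<^sub>R y)"
      unfolding elevation_def by (rule cSUP_upper[OF _ bdd_above_elevation]) simp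
    finally show ?thesis
      using t0 by (simp add: field_simps)
  qed
  then have "elevation x \<le> elevation (t *\<^sub>R x + (1 - t) *\<^sub>R y) / t"
    unfolding elevation_def[of x] by (intro cSUP_least) auto
  then show ?thesis
    using t0 by (simp add: field_simps)
qed

lemma elevation_signed_unit: "elevation (signed_unit j) \<ge> 1"
proof -
  have "1 + apply_bcontfun (signed_unit j) j \<le> elevation (signed_unit j)"
    unfolding elevation_def by (rule cSUP_upper[OF _ bdd_above_elevation]) simp
  then show ?thesis
    by (simp add: apply_signed_unit)
qed

lemma elevation_mean_signed_unit:
  assumes "finite J" "J \<noteq> {}"
  shows "elevation (\<Sum>j\<in>J. (1 / card J) *\<^sub>R signed_unit j) \<le> 2 / card J"
  unfolding elevation_def
proof (rule cSUP_least)
  fix k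
  have "apply_bcontfun (\<Sum>j\<in>J. (1 / card J) *\<^sub>R signed_unit j) k
      = (if k \<in> J then 2 / card J else 0) - 1"
    using sum_signed_unit[OF assms(1), of "\<lambda>_. 1 / card J" k] assms
    by (simp add: apply_bcontfun_sum)
  then show "1 + apply_bcontfun (\<Sum>j\<in>J. (1 / card J) *\<^sub>R signed_unit j) k \<le> 2 / card J"
    by simp
qed simp

section \<open>The nontrivial approximately convex function\<close>

theorem proposition2:
  fixes X :: "bounded_seq set"
  assumes "X = ell_infinity \<or> X = convergent_seqs"
  shows "\<exists>f :: bounded_seq \<Rightarrow> real.
           approx_convex_on (unit_ball X) f \<and>
           (\<forall>g :: bounded_seq \<Rightarrow> real. convex_on (unit_ball X) g \<longrightarrow>
              (SUP x\<in>unit_ball X. ereal \<bar>f x - g x\<bar>) = \<infinity>)"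
proof -
  define B where "B = unit_ball X"
  have B_convex: "convex B"
    unfolding B_def using assms subspace_ell_infinity subspace_convergent_seqs
    by (blast intro: subspace_convex_unit_ball)
  have B_norm: "norm x \<le> 1" if "x \<in> B" for x
    using that by (simp add: B_def unit_ball_def)
  \<comment> \<open>The pairing bijection splits the signed unit vectors into infinitely many
    infinite families.\<close>
  define v where "v n i = signed_unit (prod_encode (n, i))" for n i :: nat
  have v_eq: "case_prod v = signed_unit \<circ> prod_encode"
    by (auto simp: v_def)
  have v_B: "v n i \<in> B" for n i
    using signed_unit_in_unit_ball[OF assms] by (simp add: v_def B_def)
  have "range (case_prod v) = range signed_unit"
    unfolding v_eq image_comp[symmetric] surj_prod_encode ..
  then have ind: "independent (range (case_prod v))"
    using independent_signed_unit by simp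
  have "inj (case_prod v)"
    unfolding v_eq by (intro inj_compose inj_signed_unit inj_prod_encode)
  from independent_family_functionals[OF ind this]
  obtain \<sigma> :: "nat \<Rightarrow> bounded_seq \<Rightarrow> real"
    where linear: "\<And>n. linear (\<sigma> n)"
      and \<sigma>_v: "\<And>n m i. \<sigma> n (v m i) = (if m = n then 1 else 0)"
      and ev0: "\<And>x. \<forall>\<^sub>F n in sequentially. \<sigma> n x = 0"
    by blast

  define L where "L n x = max (1 / Suc n) (elevation x)" for n x
  define F where "F n x = - ln (L n x) + ln (Suc n) * (\<sigma> n x - 1)" for n x
  have L_pos: "L n x > 0" for n x
    by (simp add: L_def less_max_iff_disj)
  have F_convex: "eps_convex_on 1 B (F n)" for n
    unfolding F_def
  proof (intro eps_convex_on_add_linear[OF _ linear] eps_convex_on_minus_ln B_convex L_pos)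
    fix x y and t :: real assume xy: "x \<in> B" "y \<in> B" and t: "t \<in> {0..1}"
    have "t * (1 / Suc n) \<le> 1 / Suc n"
      using t by (intro mult_left_le_one_le) auto
    moreover have "t * L n x = max (t * (1 / Suc n)) (t * elevation x)"
      using t by (simp add: L_def max_mult_distrib_left)
    ultimately show "t * L n x \<le> L n (t *\<^sub>R x + (1 - t) *\<^sub>R y)"
      using elevation_scale[OF B_norm[OF xy(2)] t, of x] unfolding L_def by (metis max.mono)
  qed
  \<comment> \<open>The floor 1/(n + 1) in \<open>L\<close> caps - ln L at ln (n + 1), which cancels
    the constant of the affine term.\<close>
  have F_le: "F n x \<le> ln (Suc n) * \<sigma> n x" for n x
  proof -
    have "ln (1 / Suc n) \<le> ln (L n x)"
      by (intro ln_mono) (auto simp: L_def)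
    then show ?thesis
      by (simp add: F_def ln_div algebra_simps)
  qed
  have F_bdd: "bdd_above (range (\<lambda>n. F n x))" for x
  proof -
    obtain m where m: "\<And>n. n \<ge> m \<Longrightarrow> \<sigma> n x = 0"
      using ev0[of x] by (auto simp: eventually_sequentially)
    \<comment> \<open>Beyond \<open>m\<close> the functional vanishes and \<open>F_le\<close> gives
      a value at most 0; only finitely many values remain.\<close>
    have "F n x \<in> (\<lambda>n. F n x) ` {..<m} \<union> {..0}" for n
      using F_le[of n x] m[of n] by (cases "n < m") auto
    then have "range (\<lambda>n. F n x) \<subseteq> (\<lambda>n. F n x) ` {..<m} \<union> {..0}"
      by blast
    then show ?thesis
      by (rule bdd_above_mono[rotated]) simp
  qed
  define f where "f x = (SUP n. F n x)" for x
  have "eps_convex_on 1 B f"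
    unfolding f_def by (intro eps_convex_on_SUP F_convex F_bdd) simp
  then have "approx_convex_on B f"
    unfolding approx_convex_on_def by blast

  moreover have "(SUP x\<in>B. ereal \<bar>f x - g x\<bar>) = \<infinity>" if g: "convex_on B g" for g
  proof (rule ccontr)
    assume "(SUP x\<in>B. ereal \<bar>f x - g x\<bar>) \<noteq> \<infinity>"
    then obtain N :: nat where "\<forall>x\<in>B. \<not> ereal (real N) \<le> ereal \<bar>f x - g x\<bar>"
      using SUP_PInfty[of B "\<lambda>x. ereal \<bar>f x - g x\<bar>"] by blast
    then have close: "\<bar>f x - g x\<bar> \<le> N" if "x \<in> B" for x
      using that by force
    \<comment> \<open>For n = m the affine term vanishes and L \<ge> 1; for the other n the
      functional is 0 and \<open>F_le\<close> applies.\<close>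
    have f_v: "f (v m i) \<le> 0" for m i
      unfolding f_def
    proof (rule cSUP_least)
      fix n
      show "F n (v m i) \<le> 0"
      proof (cases "m = n")
        case True
        have "L n (v m i) \<ge> 1"
          using elevation_signed_unit[of "prod_encode (m, i)"] by (simp add: L_def v_def le_max_iff_disj)
        then show ?thesis
          using True by (simp add: F_def \<sigma>_v)
      next
        case False
        then show ?thesis
          using F_le[of n "v m i"] by (simp add: \<sigma>_v)
      qed
    qed simp
    \<comment> \<open>At the mean \<open>b\<close> of n + 1 members of family n,
      \<open>\<sigma> n b = 1\<close> removes the affine term, so \<open>f b\<close> is at least ln
      ((n + 1) / 2). But g \<le> f + N \<le> N on the family, hence \<open>g b\<close> is at most N
      by Jensen, and \<open>f b\<close> at most 2 N.\<close>
    have bound: "ln (Suc n) - ln 2 \<le> 2 * real N" for n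
    proof -
      define b where "b = (\<Sum>i\<le>n. (1 / Suc n) *\<^sub>R v n i)"
      have "b \<in> B"
        unfolding b_def by (intro convex_sum B_convex v_B) auto
      have "\<sigma> n b = 1"
        by (simp add: b_def linear_sum[OF linear] linear_cmul[OF linear] \<sigma>_v)
      let ?J = "(\<lambda>i. prod_encode (n, i)) ` {..n}"
      have inj: "inj_on (\<lambda>i. prod_encode (n, i)) {..n}"
        by (auto simp: inj_on_def)
      have "elevation b \<le> 2 / Suc n"
        using elevation_mean_signed_unit[of ?J]
        by (simp add: b_def v_def card_image[OF inj] sum.reindex[OF inj])
      then have "L n b \<le> 2 / Suc n"
        by (simp add: L_def divide_right_mono)
      then have "ln (L n b) \<le> ln (2 / Suc n)"
        using L_pos by (intro ln_mono)
      then have "ln (Suc n) - ln 2 \<le> F n b"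
        by (simp add: F_def \<open>\<sigma> n b = 1\<close> ln_div)
      also have "\<dots> \<le> f b"
        unfolding f_def by (rule cSUP_upper[OF _ F_bdd]) simp
      also have "\<dots> \<le> g b + N"
        using close[OF \<open>b \<in> B\<close>] by linarith
      also have "g b \<le> (\<Sum>i\<le>n. (1 / Suc n) * g (v n i))"
        unfolding b_def by (intro convex_on_sum[OF _ _ g]) (auto simp: v_B)
      also have "\<dots> \<le> (\<Sum>i\<le>n. (1 / Suc n) * N)"
      proof (intro sum_mono mult_left_mono)
        show "g (v n i) \<le> N" for i
          using close[OF v_B[of n i]] f_v[of n i] by linarith
      qed simp
      also have "\<dots> = N"
        by simp
      finally show ?thesis
        by simp
    qed
    have "filterlim (\<lambda>n. ln (real (Suc n))) at_top sequentially"
      by (intro filterlim_compose[OF ln_at_top] filterlim_compose[OF filterlim_real_sequentially] filterlim_Suc)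
    then obtain n where "ln (real (Suc n)) > 2 * real N + ln 2"
      unfolding filterlim_at_top_dense eventually_sequentially by blast
    then show False
      using bound[of n] by linarith
  qed
  ultimately show ?thesis
    unfolding B_def by blast
qed

end
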